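(* Let $r \geq 3$ and let $\mathbf{a}=\{a_1,a_2,\ldots,a_r\}\subset\mathbb{N}$ with $a_1<a_2<\cdots<a_r$ satisfy (i) $a_1+a_2+\cdots+a_{r-1}=a_r$; (ii) $a_j \mid 2a_r$ for all $1\leq j\leq r$; (iii) $\mathrm{GCD}(a_1,a_2,\ldots,a_r)=1$. For $k\in\mathbb{N}$ with $k\geq r$ put $$U_k(m;\mathbf{a})=\prod_{\nu=1}^{r}(2a_ra_\nu m+1)\cdot\prod_{i=1}^{k-r}\left(2^{i+1}a_r^2m+1\right),$$ where the second product is empty (equal to $1$) if $k=r$. Then: - if $k=r$, then $U_k(M;\mathbf{a})$, as a polynomial in $M$ written as the product of the $k$ linear factors $2a_ra_\nu M+1$ $(1\le\nu\le r)$, is a polynomial producing many absolute pseudoprimes with $k$ prime factors; - if $k>r$, then $U_k(2^{k-r-1}M;\mathbf{a})$, as a polynomial in $M$ written as the product of the $k$ linear factors $2^{k-r}a_ra_\nu M+1$ $(1\le\nu\le r)$ and $2^{k-r+i}a_r^2M+1$ $(1\le i\le k-r)$, is a polynomial producing many absolute pseudoprimes with $k$ prime factors.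
   Context: $\mathbb{N}$ denotes the set of positive integers. An absolute pseudoprime (Carmichael number) is a composite positive integer $N$ such that $a^{N-1}\equiv 1 \pmod N$ for every integer $a$ prime to $N$. Definition. A polynomial $P(M)=\prod_{i=1}^{k}(\alpha_iM+1)$, a product of $k$ distinct linear polynomials with $\alpha_i\in\mathbb{N}$, is called a polynomial producing many absolute pseudoprimes with $k$ prime factors if $P(M)\equiv 1 \pmod{\alpha_iM}$ for every $M\in\mathbb{N}$ and every $1\leq i\leq k$. (For $k\ge 3$, such a $P$ has the property that $P(M)$ is an absolute pseudoprime with exactly $k$ prime factors whenever all the factors $\alpha_iM+1$ are simultaneously prime.) *)

theory Defs
  imports
    "HOL-Computational_Algebra.Polynomial"
    "HOL-Number_Theory.Cong"
begin

text \<open>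
  \<open>produces_many_abs_pseudoprimes k \<alpha> P\<close>: the polynomial \<open>P\<close>, written as
  \<open>\<Prod>i=1..k. (\<alpha>\<^sub>i M + 1)\<close>, is a polynomial producing many absolute pseudoprimes with
  \<open>k\<close> prime factors. The linear polynomial \<open>\<alpha>\<^sub>i M + 1\<close> is \<open>[:1, \<alpha>\<^sub>i:]\<close>; only the values of
  \<open>\<alpha>\<close> on \<open>{1..k}\<close> matter. The coefficients \<open>\<alpha>\<^sub>i\<close> are an explicit argument, but \<open>P\<close> determines
  them up to order.
\<close>

definition produces_many_abs_pseudoprimes :: "nat \<Rightarrow> (nat \<Rightarrow> nat) \<Rightarrow> int poly \<Rightarrow> bool" where
  "produces_many_abs_pseudoprimes k \<alpha> P \<longleftrightarrow>
     (\<forall>i\<in>{1..k}. 0 < \<alpha> i) \<and>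
     inj_on (\<lambda>i. [:1, int (\<alpha> i):]) {1..k} \<and>
     P = (\<Prod>i=1..k. [:1, int (\<alpha> i):]) \<and>
     (\<forall>M::nat. 0 < M \<longrightarrow> (\<forall>i\<in>{1..k}. [poly P (int M) = 1] (mod int (\<alpha> i * M))))"

text \<open>
  \<open>U r a k\<close> is \<open>U\<^sub>k(m; a)\<close> as a polynomial in \<open>m\<close>, for \<open>a = {a\<^sub>1, \<dots>, a\<^sub>r}\<close> and \<open>k \<ge> r\<close>.
\<close>

definition U :: "nat \<Rightarrow> (nat \<Rightarrow> nat) \<Rightarrow> nat \<Rightarrow> int poly" where
  "U r a k =
     (\<Prod>\<nu>=1..r. [:1, int (2 * a r * a \<nu>):]) *
     (\<Prod>i=1..k - r. [:1, int (2 ^ (i + 1) * (a r)\<^sup>2):])"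

end

(* Put m for the variable, A = a_r and B = 4 A^2 m. Expanding to first order in 2 A m, the product
   over a is congruent to 1 + B modulo (2 A m)^2 = B m, because the a_j sum to 2 A. As B m divides
   B^2, each further factor 1 + 2^j B turns the residue 1 + 2^j B into 1 + 2^(j+1) B. Hence
   U_k(m) is congruent to 1 + 2^(k-r) B modulo (2 A m)^2, and both claims follow by divisibility. *)

theory Submission
  imports Defs
begin

text \<open>Every term of the expanded product that uses two or more of the \<open>c * x i\<close>
  is a multiple of \<open>c\<^sup>2\<close>, so only the constant and linear terms survive.\<close>

lemma prod_linear_cong:
  fixes c :: "'a :: unique_euclidean_ring"
  assumes "finite I"
  shows "[(\<Prod>i\<in>I. 1 + c * x i) = 1 + c * (\<Sum>i\<in>I. x i)] (mod c\<^sup>2)"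
  using assms
proof (induction I)
  case empty
  then show ?case by simp
next
  case (insert j I)
  have "[(1 + c * x j) * (\<Prod>i\<in>I. 1 + c * x i) = (1 + c * x j) * (1 + c * (\<Sum>i\<in>I. x i))] (mod c\<^sup>2)"
    using insert.IH by (rule cong_scalar_left)
  also have "(1 + c * x j) * (1 + c * (\<Sum>i\<in>I. x i)) =
      1 + c * (\<Sum>i\<in>insert j I. x i) + c\<^sup>2 * (x j * (\<Sum>i\<in>I. x i))"
    using insert.hyps by (simp add: algebra_simps power2_eq_square)
  also have "[\<dots> = 1 + c * (\<Sum>i\<in>insert j I. x i)] (mod c\<^sup>2)"
    by (simp add: cong_iff_dvd_diff)
  finally show ?case
    using insert.hyps by simp
qed

text \<open>The factor with index s + 1 equals the residue accumulated so far, so appending it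
  squares that residue: (1 + x)^2 = 1 + 2 x + x^2 with x = 2^s B, and \<open>n\<close> divides x^2.
  The exponent \<open>i - 1\<close> makes the first appended factor another 1 + B.\<close>

lemma prod_doubling_cong:
  fixes B :: "'a :: unique_euclidean_ring"
  assumes "n dvd B\<^sup>2"
  shows "[(1 + B) * (\<Prod>i=1..s. 1 + 2 ^ (i - 1) * B) = 1 + 2 ^ s * B] (mod n)"
proof (induction s)
  case 0
  then show ?case by simp
next
  case (Suc s)
  have "[(1 + B) * (\<Prod>i=1..s. 1 + 2 ^ (i - 1) * B) * (1 + 2 ^ s * B) =
      (1 + 2 ^ s * B) * (1 + 2 ^ s * B)] (mod n)"
    using Suc.IH by (rule cong_scalar_right)
  also have "(1 + 2 ^ s * B) * (1 + 2 ^ s * B) = 1 + 2 ^ Suc s * B + 2 ^ s * 2 ^ s * B\<^sup>2"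
    by (simp add: algebra_simps power2_eq_square)
  also have "[\<dots> = 1 + 2 ^ Suc s * B] (mod n)"
    using assms by (simp add: cong_iff_dvd_diff)
  finally show ?case
    by (simp add: mult.assoc)
qed

lemma poly_U_cong:
  fixes m :: int
  assumes "(\<Sum>j=1..r. a j) = 2 * a r"
  shows "[poly (U r a k) m = 1 + 2 ^ (k - r) * (4 * (int (a r))\<^sup>2 * m)] (mod (2 * int (a r) * m)\<^sup>2)"
proof -
  define A where "A = int (a r)"
  define B where "B = 4 * A\<^sup>2 * m"
  define c where "c = 2 * A * m"
  have sum: "(\<Sum>j=1..r. int (a j)) = 2 * A"
    using assms by (metis A_def of_nat_sum of_nat_mult of_nat_numeral)
  have P: "poly (U r a k) m =
      (\<Prod>j=1..r. 1 + c * int (a j)) * (\<Prod>i=1..k - r. 1 + 2 ^ (i - 1) * B)"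
  proof -
    \<comment> \<open>Two powers of 2 move into B = 4 A^2 m; the subtraction in \<open>i - 1\<close>
      does not truncate because i is at least 1.\<close>
    have "1 + m * (2 ^ (i + 1) * A\<^sup>2) = 1 + 2 ^ (i - 1) * B" if "i \<in> {1..k - r}" for i
      using that by (cases i) (auto simp: B_def)
    then have "(\<Prod>i=1..k - r. 1 + m * (2 ^ (i + 1) * A\<^sup>2)) = (\<Prod>i=1..k - r. 1 + 2 ^ (i - 1) * B)"
      by (intro prod.cong refl)
    then show ?thesis
      by (simp add: U_def poly_prod A_def c_def mult_ac)
  qed
  have "[(\<Prod>j=1..r. 1 + c * int (a j)) = 1 + c * (\<Sum>j=1..r. int (a j))] (mod c\<^sup>2)"
    by (rule prod_linear_cong) simp
  \<comment> \<open>The sum condition makes the linear term 2 A m * 2 A, which is exactly B; this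
    starts the doubling.\<close>
  also have "1 + c * (\<Sum>j=1..r. int (a j)) = 1 + B"
    unfolding sum by (simp add: c_def B_def power2_eq_square)
  finally have "[poly (U r a k) m = (1 + B) * (\<Prod>i=1..k - r. 1 + 2 ^ (i - 1) * B)] (mod c\<^sup>2)"
    unfolding P by (rule cong_scalar_right)
  moreover have "B\<^sup>2 = c\<^sup>2 * (4 * A\<^sup>2)"
    by (simp add: B_def c_def power2_eq_square)
  then have "[(1 + B) * (\<Prod>i=1..k - r. 1 + 2 ^ (i - 1) * B) = 1 + 2 ^ (k - r) * B] (mod c\<^sup>2)"
    by (intro prod_doubling_cong) simp
  ultimately show ?thesis
    unfolding A_def B_def c_def by (rule cong_trans)
qed

text \<open>Distinctness of the linear factors will be read off from coefficients listed in
  increasing order.\<close>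

lemma inj_on_linear_poly:
  fixes f :: "'a :: linorder \<Rightarrow> nat"
  assumes "strict_mono_on S f"
  shows "inj_on (\<lambda>i. [:1, int (f i):]) S"
  using strict_mono_on_imp_inj_on[OF assms] by (auto simp: inj_on_def)

theorem theorem2p1:
  fixes r k :: nat and a :: "nat \<Rightarrow> nat"
  assumes "r \<ge> 3"
    and "\<forall>j\<in>{1..r}. 0 < a j"
    and "strict_mono_on {1..r} a"
    and "(\<Sum>j=1..r - 1. a j) = a r"
    and "\<forall>j\<in>{1..r}. a j dvd 2 * a r"
    and "Gcd (a ` {1..r}) = 1"
    and "k \<ge> r"
  shows "(k = r \<longrightarrow>
            produces_many_abs_pseudoprimes k (\<lambda>\<nu>. 2 * a r * a \<nu>) (U r a k)) \<and>
         (k > r \<longrightarrow>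
            produces_many_abs_pseudoprimes k
              (\<lambda>j. if j \<le> r then 2 ^ (k - r) * a r * a j
                   else 2 ^ (k - r + (j - r)) * (a r)\<^sup>2)
              (pcompose (U r a k) [:0, 2 ^ (k - r - 1):]))"
proof (intro conjI impI)
  have Apos: "0 < a r"
    using assms(1,2) by simp
  have "{1..r} = insert r {1..r - 1}"
    using assms(1) by auto
  then have sum: "(\<Sum>j=1..r. a j) = 2 * a r"
    using assms(1,4) by simp
  have mono: "a i < a j" if "1 \<le> i" "i < j" "j \<le> r" for i j
    using strict_mono_onD[OF assms(3)] that by simp
  {
    assume "k = r"
    show "produces_many_abs_pseudoprimes k (\<lambda>\<nu>. 2 * a r * a \<nu>) (U r a k)"
      unfolding produces_many_abs_pseudoprimes_def
    proof (intro conjI ballI allI impI)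
      fix i assume "i \<in> {1..k}"
      then show "0 < 2 * a r * a i"
        using Apos assms(2) \<open>k = r\<close> by simp
    next
      show "inj_on (\<lambda>i. [:1, int (2 * a r * a i):]) {1..k}"
        using Apos mono \<open>k = r\<close> by (intro inj_on_linear_poly strict_mono_onI) auto
    next
      show "U r a k = (\<Prod>i = 1..k. [:1, int (2 * a r * a i):])"
        using \<open>k = r\<close> by (simp add: U_def)
    next
      fix M i :: nat assume "i \<in> {1..k}"
      \<comment> \<open>Condition (ii) replaces \<open>a i\<close> by \<open>2 * a r\<close>. The
        resulting multiple 4 A^2 M is both the excess of the residue over 1 and a divisor of the
        modulus (2 A M)^2.\<close>
      then have "2 * a r * a i * M dvd 2 * a r * (2 * a r) * M"
        using assms(5) \<open>k = r\<close> by (intro mult_dvd_mono) auto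
      then have "int (2 * a r * a i * M) dvd int (2 * a r * (2 * a r) * M)"
        by (simp only: of_nat_dvd_iff)
      then have dvd: "int (2 * a r * a i * M) dvd 4 * (int (a r))\<^sup>2 * int M"
        by (simp add: power2_eq_square mult_ac)
      then have "int (2 * a r * a i * M) dvd (2 * int (a r) * int M)\<^sup>2"
        by (rule dvd_trans) (simp add: power2_eq_square)
      with poly_U_cong[OF sum, of k "int M"]
      have "[poly (U r a k) (int M) = 1 + 4 * (int (a r))\<^sup>2 * int M] (mod int (2 * a r * a i * M))"
        using \<open>k = r\<close> by (auto intro: cong_dvd_modulus)
      also have "[1 + 4 * (int (a r))\<^sup>2 * int M = 1] (mod int (2 * a r * a i * M))"
        using dvd by (simp add: cong_iff_dvd_diff)
      finally show "[poly (U r a k) (int M) = 1] (mod int (2 * a r * a i * M))" .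
    qed
  next
    assume "k > r"
    \<comment> \<open>Here t = k - r - 1 is the exponent in the substitution of 2^t M for the
      variable.\<close>
    then obtain t where k: "k = r + Suc t"
      using less_iff_Suc_add by auto
    define \<alpha> where "\<alpha> = (\<lambda>j. if j \<le> r then 2 ^ (k - r) * a r * a j
                              else 2 ^ (k - r + (j - r)) * (a r)\<^sup>2)"
    have "produces_many_abs_pseudoprimes k \<alpha> (pcompose (U r a k) [:0, 2 ^ (k - r - 1):])"
      unfolding produces_many_abs_pseudoprimes_def
    proof (intro conjI ballI allI impI)
      fix i assume "i \<in> {1..k}"
      then show "0 < \<alpha> i"
        using Apos assms(2) by (simp add: \<alpha>_def)
    next
      \<comment> \<open>Across the two blocks, the largest coefficient of the first, 2^(k-r) a_r^2
        at index r, lies below the smallest of the second, 2^(k-r+1) a_r^2.\<close>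
      have "\<alpha> i < \<alpha> j" if "i \<in> {1..k}" "j \<in> {1..k}" "i < j" for i j
      proof (cases "i \<le> r")
        case True
        show ?thesis
        proof (cases "j \<le> r")
          case True
          then show ?thesis
            using that \<open>i \<le> r\<close> Apos mono by (simp add: \<alpha>_def)
        next
          case False
          have "a i \<le> a r"
            using mono[of i r] that \<open>i \<le> r\<close> by (cases "i = r") auto
          then have "2 ^ (k - r) * a r * a i \<le> 2 ^ (k - r) * (a r)\<^sup>2"
            by (simp add: power2_eq_square)
          also have "\<dots> < 2 ^ (k - r + (j - r)) * (a r)\<^sup>2"
            using Apos False by simp
          finally show ?thesis
            using \<open>i \<le> r\<close> False by (simp add: \<alpha>_def)
        qed
      next
        case False
        then show ?thesis
          using that Apos by (simp add: \<alpha>_def diff_less_mono)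
      qed
      then show "inj_on (\<lambda>i. [:1, int (\<alpha> i):]) {1..k}"
        by (intro inj_on_linear_poly strict_mono_onI)
    next
      \<comment> \<open>Split at r and shift the second block to start at 1; the substitution then
        multiplies each coefficient of \<open>U r a k\<close> by 2^t, and i + 1 + t = k - r +
        i.\<close>
      have "(\<Prod>i=1..k. [:1, int (\<alpha> i):]) =
          (\<Prod>i=1..r. [:1, int (\<alpha> i):]) * (\<Prod>i=r + 1..r + Suc t. [:1, int (\<alpha> i):])"
        unfolding k by (rule prod.ub_add_nat) simp
      also have "(\<Prod>i=r + 1..r + Suc t. [:1, int (\<alpha> i):]) =
          (\<Prod>i=1..Suc t. [:1, int (\<alpha> (i + r)):])"
        using prod.shift_bounds_cl_nat_ivl[of "\<lambda>i. [:1, int (\<alpha> i):]" 1 r "Suc t"]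
        by (simp add: add.commute)
      also have "\<dots> = (\<Prod>i=1..k - r. pcompose [:1, int (2 ^ (i + 1) * (a r)\<^sup>2):] [:0, 2 ^ t:])"
        by (intro prod.cong) (auto simp: \<alpha>_def k pcompose_pCons power_add mult_ac)
      also have "(\<Prod>i=1..r. [:1, int (\<alpha> i):]) =
          (\<Prod>\<nu>=1..r. pcompose [:1, int (2 * a r * a \<nu>):] [:0, 2 ^ t:])"
        by (intro prod.cong) (auto simp: \<alpha>_def k pcompose_pCons mult_ac)
      finally show "pcompose (U r a k) [:0, 2 ^ (k - r - 1):] = (\<Prod>i=1..k. [:1, int (\<alpha> i):])"
        unfolding U_def pcompose_mult pcompose_prod using k by simp
    next
      fix M i :: nat assume i: "i \<in> {1..k}"
      define m where "m = 2 ^ t * int M"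
      \<comment> \<open>D = 4^(t+1) a_r^2 M is chosen as a common multiple of all
        \<open>\<alpha> i * M\<close>. The modulus (2 a_r m)^2 is D M and the residue is 1 + 2 D, so
        divisibility of D settles both.\<close>
      define D where "D = 2 ^ t * (4 * (int (a r))\<^sup>2 * m)"
      have "\<alpha> i * M dvd 2 ^ Suc t * 2 ^ Suc t * (a r)\<^sup>2 * M"
      proof (cases "i \<le> r")
        case True
        \<comment> \<open>By condition (ii) the coefficient divides 2^(t+2) a_r^2; the missing
          factor up to D is 2^t.\<close>
        then have "2 ^ Suc t * a r * a i * M dvd 2 ^ Suc t * a r * (2 * a r) * M"
          using assms(5) i by (intro mult_dvd_mono) auto
        also have "\<dots> dvd 2 ^ t * (2 ^ Suc t * a r * (2 * a r) * M)"
          by (rule dvd_triv_right)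
        finally show ?thesis
          using True by (simp add: \<alpha>_def k power2_eq_square mult_ac)
      next
        case False
        \<comment> \<open>Since i is at most k, i - r is at most t + 1. Equality holds at i = k,
          where \<open>\<alpha> i * M\<close> is D itself.\<close>
        then have "(2::nat) ^ (Suc t + (i - r)) dvd 2 ^ (Suc t + Suc t)"
          using i k by (intro le_imp_power_dvd) auto
        then have "2 ^ (Suc t + (i - r)) * (a r)\<^sup>2 * M dvd 2 ^ (Suc t + Suc t) * (a r)\<^sup>2 * M"
          by (intro mult_dvd_mono) auto
        then show ?thesis
          using False by (simp add: \<alpha>_def k power_add mult_ac)
      qed
      then have "int (\<alpha> i * M) dvd int (2 ^ Suc t * 2 ^ Suc t * (a r)\<^sup>2 * M)"
        by (simp only: of_nat_dvd_iff)
      also have "int (2 ^ Suc t * 2 ^ Suc t * (a r)\<^sup>2 * M) = D"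
        by (simp add: D_def m_def)
      finally have dvd: "int (\<alpha> i * M) dvd D" .
      also have "D dvd D * int M"
        by simp
      also have "D * int M = (2 * int (a r) * m)\<^sup>2"
        by (simp add: D_def m_def power2_eq_square)
      finally have "[poly (U r a k) m = 1 + 2 ^ (k - r) * (4 * (int (a r))\<^sup>2 * m)] (mod int (\<alpha> i * M))"
        by (rule cong_dvd_modulus[OF poly_U_cong[OF sum]])
      also have "1 + 2 ^ (k - r) * (4 * (int (a r))\<^sup>2 * m) = 1 + 2 * D"
        by (simp add: D_def k)
      also have "[1 + 2 * D = 1] (mod int (\<alpha> i * M))"
        using dvd by (simp add: cong_iff_dvd_diff)
      finally show "[poly (pcompose (U r a k) [:0, 2 ^ (k - r - 1):]) (int M) = 1] (mod int (\<alpha> i * M))"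
        by (simp add: poly_pcompose m_def k mult.commute)
    qed
    then show "produces_many_abs_pseudoprimes k
              (\<lambda>j. if j \<le> r then 2 ^ (k - r) * a r * a j
                   else 2 ^ (k - r + (j - r)) * (a r)\<^sup>2)
              (pcompose (U r a k) [:0, 2 ^ (k - r - 1):])"
      unfolding \<alpha>_def .
  }
qed

end
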